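(* Let $\alpha>0$, let $w\in\mathbb{C}$ with $|w|=1$, let $\varphi(z)=wz$ for $z\in\mathbb{C}$, and let $C_\varphi$ be the composition operator $C_\varphi f=f\circ\varphi$ on the Fock space $F^2_\alpha$. Then the set of extended eigenvalues of $C_\varphi$ is $$\mathrm{Ext}(C_\varphi)=\{w^n : n\in\mathbb{Z}\}.$$
   Context: For $\alpha>0$, the Fock space $F^2_\alpha$ is the Hilbert space of entire functions $f:\mathbb{C}\to\mathbb{C}$ with $\|f\|^2=\frac{\alpha}{\pi}\int_{\mathbb{C}}|f(z)|^2e^{-\alpha|z|^2}\,dA(z)<\infty$, where $dA$ is Lebesgue area measure. For a bounded linear operator $A$ on a complex Hilbert space $H$, a scalar $\lambda\in\mathbb{C}$ is an extended eigenvalue of $A$ if there is a nonzero bounded linear operator $X$ on $H$ with $AX=\lambda XA$; $\mathrm{Ext}(A)$ denotes the set of all extended eigenvalues of $A$. *)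

theory Defs
  imports "HOL-Complex_Analysis.Complex_Analysis"
begin

definition fock_space :: "real \<Rightarrow> (complex \<Rightarrow> complex) set" where
  "fock_space \<alpha> =
     {f. f holomorphic_on UNIV \<and>
         integrable lborel (\<lambda>z. (cmod (f z))\<^sup>2 * exp (- \<alpha> * (cmod z)\<^sup>2))}"

definition fock_norm :: "real \<Rightarrow> (complex \<Rightarrow> complex) \<Rightarrow> real" where
  "fock_norm \<alpha> f =
     sqrt (\<alpha> / pi * (LINT z|lborel. (cmod (f z))\<^sup>2 * exp (- \<alpha> * (cmod z)\<^sup>2)))"

text \<open>
  A Hilbert space of complex-valued functions is given by its carrier \<open>H\<close>, with pointwise
  vector operations, and its norm \<open>N\<close>.  Operators on \<open>H\<close> are total functions of which only the
  values on \<open>H\<close> matter; in particular, operators are compared on \<open>H\<close> only.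
\<close>

definition bounded_operator ::
  "('a \<Rightarrow> complex) set \<Rightarrow> (('a \<Rightarrow> complex) \<Rightarrow> real) \<Rightarrow>
   (('a \<Rightarrow> complex) \<Rightarrow> ('a \<Rightarrow> complex)) \<Rightarrow> bool" where
  "bounded_operator H N T \<longleftrightarrow>
     (\<forall>f\<in>H. T f \<in> H) \<and>
     (\<forall>f\<in>H. \<forall>g\<in>H. T (\<lambda>z. f z + g z) = (\<lambda>z. T f z + T g z)) \<and>
     (\<forall>c. \<forall>f\<in>H. T (\<lambda>z. c * f z) = (\<lambda>z. c * T f z)) \<and>
     (\<exists>B. \<forall>f\<in>H. N (T f) \<le> B * N f)"

text \<open>Only meaningful for an operator \<open>A\<close> satisfying \<^term>\<open>bounded_operator H N A\<close>.\<close>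

definition Ext ::
  "('a \<Rightarrow> complex) set \<Rightarrow> (('a \<Rightarrow> complex) \<Rightarrow> real) \<Rightarrow>
   (('a \<Rightarrow> complex) \<Rightarrow> ('a \<Rightarrow> complex)) \<Rightarrow> complex set" where
  "Ext H N A =
     {\<mu>. \<exists>X. bounded_operator H N X \<and> (\<exists>f\<in>H. X f \<noteq> (\<lambda>z. 0)) \<and>
            (\<forall>f\<in>H. A (X f) = (\<lambda>z. \<mu> * X (A f) z))}"

definition composition_operator ::
  "('a \<Rightarrow> 'a) \<Rightarrow> ('a \<Rightarrow> complex) \<Rightarrow> ('a \<Rightarrow> complex)" where
  "composition_operator \<phi> f = f \<circ> \<phi>"

end

theory Submission
  imports Defs "HOL-Probability.Distributions"
begin

text \<open>
  The composition operator is diagonal on the monomials: it multiplies \<open>z\<^sup>n\<close> by \<open>w\<^sup>n\<close>.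

  Every power of \<open>w\<close> is therefore an extended eigenvalue. If \<open>n = k - m\<close>, the operator that sends
  \<open>f\<close> to its \<open>m\<close>-th Taylor coefficient times \<open>z\<^sup>k\<close> satisfies the intertwining relation for \<open>w\<^sup>n\<close>,
  and it is bounded because Taylor coefficients depend continuously on \<open>f\<close> in the Fock norm
  (\<open>fock_coeff_bound\<close>).

  Conversely, let \<open>X\<close> be a nonzero bounded operator that intertwines with the factor \<open>\<mu>\<close>. It cannot
  annihilate all monomials, since polynomials are dense (\<open>bounded_operator_eq_0_if_monomials\<close>). If
  \<open>g = X z\<^sup>m\<close> is nonzero, the relation at \<open>z\<^sup>m\<close> reads \<open>g (w z) = \<mu> w\<^sup>m g z\<close>, and comparing any nonzero
  Taylor coefficient, say the \<open>k\<close>-th, gives \<open>w\<^sup>k = \<mu> w\<^sup>m\<close>.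

  The analytic content is thus the orthogonal expansion in monomials. Lebesgue measure is invariant
  under rotations (\<open>lborel_distr_orthogonal\<close>), so different monomials are orthogonal for every
  rotation-invariant weight, in particular for the Gaussian weight restricted to a disc. On a disc
  the Taylor series converges uniformly, which gives the Pythagorean decomposition of an entire
  function into a Taylor polynomial and its remainder. Letting the disc exhaust the plane yields
  the decomposition for the Gaussian weight (\<open>taylor_pythagoras\<close>), and from it both the bound on
  the coefficients and the convergence of the Taylor polynomials in norm
  (\<open>taylor_remainder_tendsto_0\<close>).
\<close>

section \<open>Invariance of Lebesgue measure under orthogonal transformations\<close>

lemma nn_integral_lborel_translate:
  fixes c :: "'a::euclidean_space"
  assumes [measurable]: "h \<in> borel_measurable borel"
  shows "(\<integral>\<^sup>+x. h (c + x) \<partial>lborel) = (\<integral>\<^sup>+x. h x \<partial>lborel)"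
proof -
  have "(\<integral>\<^sup>+x. h x \<partial>lborel) = (\<integral>\<^sup>+x. h x \<partial>distr lborel borel ((+) c))"
    by (simp add: lborel_distr_plus)
  also have "\<dots> = (\<integral>\<^sup>+x. h (c + x) \<partial>lborel)"
    by (rule nn_integral_distr) auto
  finally show ?thesis ..
qed

lemma nn_integral_lborel_reflect:
  fixes c :: "'a::euclidean_space"
  assumes [measurable]: "h \<in> borel_measurable borel"
  shows "(\<integral>\<^sup>+x. h (c - x) \<partial>lborel) = (\<integral>\<^sup>+x. h x \<partial>lborel)"
proof -
  have "lborel = density (distr lborel borel (\<lambda>x. c + (-1) *\<^sub>R x)) (\<lambda>_. \<bar>-1::real\<bar>^DIM('a))"
    by (rule lborel_affine) simp
  then have "lborel = distr lborel borel (\<lambda>x. c - x)"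
    by (simp add: density_1)
  then have "(\<integral>\<^sup>+x. h x \<partial>lborel) = (\<integral>\<^sup>+x. h x \<partial>distr lborel borel (\<lambda>x. c - x))"
    by simp
  also have "\<dots> = (\<integral>\<^sup>+x. h (c - x) \<partial>lborel)"
    by (rule nn_integral_distr) auto
  finally show ?thesis ..
qed

text \<open>
  This is Weil's argument that an invariant measure is unique up to a factor. With \<open>g\<close> the
  indicator of the unit ball, which \<open>T\<close> preserves, the double integral of
  \<open>g (T y + x) * 1\<^sub>A (T y)\<close> is evaluated in two ways. Integrating over \<open>x\<close> first gives the volume of
  the ball times the pushed-forward measure of \<open>A\<close>; shifting \<open>y\<close> first and then integrating over
  \<open>x\<close> gives the volume of the ball times the Lebesgue measure of \<open>A\<close>. Since the volume of the ball
  is positive and finite, it cancels.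
\<close>
lemma lborel_distr_orthogonal:
  fixes T :: "'a::euclidean_space \<Rightarrow> 'a"
  assumes T: "orthogonal_transformation T"
  shows "distr lborel borel T = lborel"
proof (rule measure_eqI)
  fix A assume "A \<in> sets (distr lborel borel T)"
  then have [measurable]: "A \<in> sets borel" by simp
  have lin: "linear T" using T by (rule orthogonal_transformation_linear)
  have [measurable]: "T \<in> borel_measurable borel"
    using lin by (intro borel_measurable_continuous_onI linear_continuous_on linear_conv_bounded_linear[THEN iffD1])
  obtain T' where T': "\<And>x. T (T' x) = x" and [measurable]: "T' \<in> borel_measurable borel"
  proof
    show "T (inv T x) = x" for x
      using orthogonal_transformation_surj[OF T] by (simp add: surj_f_inv_f)
    show "inv T \<in> borel_measurable borel"
      using orthogonal_transformation_linear[OF orthogonal_transformation_inv[OF T]]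
      by (intro borel_measurable_continuous_onI linear_continuous_on linear_conv_bounded_linear[THEN iffD1])
  qed
  define g :: "'a \<Rightarrow> ennreal" where "g = indicator (ball 0 1)"
  have [measurable]: "g \<in> borel_measurable borel" unfolding g_def by (intro borel_measurable_indicator) auto
  have gT: "g (T y) = g y" for y
    by (simp add: g_def indicator_def orthogonal_transformation_norm[OF T])
  have nng: "(\<integral>\<^sup>+x. g x \<partial>lborel) = emeasure lborel (ball (0::'a) 1)"
    by (simp add: g_def)
  have pos: "emeasure lborel (ball (0::'a) 1) \<noteq> 0"
    by (simp add: emeasure_ball unit_ball_vol_pos ennreal_eq_0_iff not_le)
  have fin: "emeasure lborel (ball (0::'a) 1) \<noteq> top"
    using emeasure_lborel_ball_finite[of "0::'a" 1] by simp
  let ?b = "emeasure lborel (ball (0::'a) 1)"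
  have "?b * emeasure (distr lborel borel T) A = ?b * (\<integral>\<^sup>+y. indicator A (T y) \<partial>lborel)"
    by (simp add: nn_integral_distr flip: nn_integral_indicator)
  also have "\<dots> = (\<integral>\<^sup>+y. ?b * indicator A (T y) \<partial>lborel)"
    by (rule nn_integral_cmult[symmetric]) measurable
  also have "\<dots> = (\<integral>\<^sup>+y. (\<integral>\<^sup>+x. g (T y + x) * indicator A (T y) \<partial>lborel) \<partial>lborel)"
    by (subst nn_integral_multc) (auto simp: nn_integral_lborel_translate nng)
  also have "\<dots> = (\<integral>\<^sup>+x. (\<integral>\<^sup>+y. g (T y + x) * indicator A (T y) \<partial>lborel) \<partial>lborel)"
    by (rule lborel_pair.Fubini') measurable
  also have "\<dots> = (\<integral>\<^sup>+x. (\<integral>\<^sup>+y. g y * indicator A (T y - x) \<partial>lborel) \<partial>lborel)"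
  proof (rule nn_integral_cong)
    fix x
    have "(\<integral>\<^sup>+y. g y * indicator A (T y - x) \<partial>lborel)
        = (\<integral>\<^sup>+y. g (T' x + y) * indicator A (T (T' x + y) - x) \<partial>lborel)"
      by (rule nn_integral_lborel_translate[symmetric]) measurable
    also have "\<dots> = (\<integral>\<^sup>+y. g (T y + x) * indicator A (T y) \<partial>lborel)"
    proof (rule nn_integral_cong)
      fix y
      have "T (T' x + y) = T y + x" by (simp add: linear_add[OF lin] T')
      then show "g (T' x + y) * indicator A (T (T' x + y) - x) = g (T y + x) * indicator A (T y)"
        using gT[of "T' x + y"] by simp
    qed
    finally show "(\<integral>\<^sup>+y. g (T y + x) * indicator A (T y) \<partial>lborel) = (\<integral>\<^sup>+y. g y * indicator A (T y - x) \<partial>lborel)" ..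
  qed
  also have "\<dots> = (\<integral>\<^sup>+y. (\<integral>\<^sup>+x. g y * indicator A (T y - x) \<partial>lborel) \<partial>lborel)"
    by (rule lborel_pair.Fubini') measurable
  also have "\<dots> = (\<integral>\<^sup>+y. g y * emeasure lborel A \<partial>lborel)"
    by (subst nn_integral_cmult) (auto simp: nn_integral_lborel_reflect)
  also have "\<dots> = ?b * emeasure lborel A"
    by (subst nn_integral_multc) (auto simp: nng)
  finally show "emeasure (distr lborel borel T) A = emeasure lborel A"
    using pos fin by (simp add: ennreal_mult_cancel_left)
qed simp


lemma distr_density_invariant:
  assumes [measurable]: "T \<in> M \<rightarrow>\<^sub>M N" "g \<in> borel_measurable N"
    and T: "distr M N T = M" and g: "\<And>x. x \<in> space M \<Longrightarrow> g (T x) = g x"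
  shows "distr (density M g) N T = density M g"
proof -
  have sets: "sets M = sets N" using T by (metis sets_distr)
  then have [measurable]: "g \<in> borel_measurable M" by (simp cong: measurable_cong_sets)
  have "density M g = density (distr M N T) g" by (simp add: T)
  also have "\<dots> = distr (density M (\<lambda>x. g (T x))) N T"
    by (rule density_distr) auto
  also have "density M (\<lambda>x. g (T x)) = density M g"
    by (intro density_cong) (auto simp: g)
  finally show ?thesis ..
qed

section \<open>Taylor polynomials of entire functions\<close>

definition taylor_coeff :: "(complex \<Rightarrow> complex) \<Rightarrow> nat \<Rightarrow> complex" where
  "taylor_coeff f n = (deriv ^^ n) f 0 / fact n"

definition taylor_sum :: "(complex \<Rightarrow> complex) \<Rightarrow> nat \<Rightarrow> complex \<Rightarrow> complex" where
  "taylor_sum f N z = (\<Sum>n<N. taylor_coeff f n * z ^ n)"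

lemma taylor_sum_tendsto:
  assumes "f holomorphic_on UNIV"
  shows "(\<lambda>N. taylor_sum f N z) \<longlonglongrightarrow> f z"
proof -
  have "f holomorphic_on ball 0 (cmod z + 1)"
    using assms holomorphic_on_subset by blast
  from holomorphic_power_series[OF this, of z]
  show ?thesis
    by (simp add: taylor_sum_def taylor_coeff_def sums_def)
qed

lemma entire_eq_0_if_taylor_coeff_eq_0:
  assumes "f holomorphic_on UNIV" "\<And>n. taylor_coeff f n = 0"
  shows "f z = 0"
  using taylor_sum_tendsto[OF assms(1), of z] assms(2)
  by (simp add: taylor_sum_def LIMSEQ_const_iff)

lemma taylor_coeff_add:
  assumes "f holomorphic_on UNIV" "g holomorphic_on UNIV"
  shows "taylor_coeff (\<lambda>z. f z + g z) n = taylor_coeff f n + taylor_coeff g n"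
  using higher_deriv_add[OF assms, of 0 n] by (simp add: taylor_coeff_def add_divide_distrib)

lemma taylor_coeff_cmult:
  assumes "f holomorphic_on UNIV"
  shows "taylor_coeff (\<lambda>z. c * f z) n = c * taylor_coeff f n"
  using higher_deriv_cmult[OF assms, of 0 n c] by (simp add: taylor_coeff_def)

lemma taylor_coeff_rotate:
  assumes "f holomorphic_on UNIV"
  shows "taylor_coeff (\<lambda>z. f (u * z)) n = u ^ n * taylor_coeff f n"
  using higher_deriv_compose_linear[OF assms, of UNIV 0 u n] by (simp add: taylor_coeff_def)

lemma taylor_coeff_monomial: "taylor_coeff (\<lambda>z. z ^ n) n = 1"
  using higher_deriv_power[of n 0 n 0] by (simp add: taylor_coeff_def pochhammer_fact[symmetric])

text \<open>
  One bound serves all partial sums at once, so that it can dominate them when a limit is taken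
  under the integral over a disc.
\<close>
lemma taylor_sum_bounded_on_cball:
  assumes "f holomorphic_on UNIV"
  obtains B where "\<And>N z. cmod z \<le> R \<Longrightarrow> cmod (taylor_sum f N z) \<le> B"
proof
  let ?R = "max R 0"
  have "summable (\<lambda>n. taylor_coeff f n * of_real (?R + 1) ^ n)"
    using taylor_sum_tendsto[OF assms, of "of_real (?R + 1)"]
    unfolding taylor_sum_def by (auto simp: summable_def sums_def)
  then have "summable (\<lambda>n. norm (taylor_coeff f n * of_real ?R ^ n))"
    by (rule powser_insidea) (simp del: of_real_add)
  then have sm: "summable (\<lambda>n. cmod (taylor_coeff f n) * ?R ^ n)"
    by (simp add: norm_mult norm_power)
  fix N z assume z: "cmod z \<le> R"
  have "cmod (taylor_sum f N z) \<le> (\<Sum>n<N. cmod (taylor_coeff f n) * ?R ^ n)"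
    unfolding taylor_sum_def using z
    by (intro sum_norm_le) (auto simp: norm_mult norm_power intro!: mult_left_mono power_mono)
  also have "\<dots> \<le> (\<Sum>n. cmod (taylor_coeff f n) * ?R ^ n)"
    by (intro sum_le_suminf sm) auto
  finally show "cmod (taylor_sum f N z) \<le> (\<Sum>n. cmod (taylor_coeff f n) * ?R ^ n)" .
qed

section \<open>Orthogonal expansion with respect to a radial measure\<close>

text \<open>
  Rotation invariance is all that orthogonality of the monomials requires, and finite moments make
  polynomials square integrable. Apart from the Gaussian measure itself, its restrictions to discs
  are of this kind, and the passage from polynomials to entire functions needs both.
\<close>
locale radial_measure =
  fixes M :: "complex measure"
  assumes sets_eq_borel [measurable_cong]: "sets M = sets borel"
    and rotation: "cmod u = 1 \<Longrightarrow> distr M borel ((*) u) = M"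
    and integrable_moment: "integrable M (\<lambda>z. cmod z ^ n)"
begin

text \<open>
  Rotating by the angle \<open>\<pi> / (m - n)\<close> multiplies the integrand by \<open>- 1\<close> and leaves the integral
  unchanged.
\<close>
lemma monomials_orthogonal:
  assumes "m \<noteq> n"
  shows "(LINT z|M. z ^ m * cnj (z ^ n)) = 0"
proof -
  define u where "u = cis (pi / (real m - real n))"
  have u: "cmod u = 1" by (simp add: u_def)
  have "u ^ m * cnj (u ^ n) = cis (real m * (pi / (real m - real n)) - real n * (pi / (real m - real n)))"
    by (simp add: u_def Complex.DeMoivre cis_cnj cis_mult)
  also have "real m * (pi / (real m - real n)) - real n * (pi / (real m - real n)) = pi"
    unfolding left_diff_distrib[symmetric] using assms by simp
  finally have u': "u ^ m * cnj (u ^ n) = -1" by simp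
  have "(LINT z|M. z ^ m * cnj (z ^ n)) = (LINT z|distr M borel ((*) u). z ^ m * cnj (z ^ n))"
    by (simp add: rotation u)
  also have "\<dots> = (LINT z|M. (u * z) ^ m * cnj ((u * z) ^ n))"
    by (rule integral_distr) (auto intro!: borel_measurable_continuous_onI continuous_intros)
  also have "\<dots> = (LINT z|M. (u ^ m * cnj (u ^ n)) * (z ^ m * cnj (z ^ n)))"
    by (simp add: power_mult_distrib mult_ac)
  also have "\<dots> = - (LINT z|M. z ^ m * cnj (z ^ n))"
    unfolding u' by simp
  finally show ?thesis by simp
qed

lemma integrable_monomials: "integrable M (\<lambda>z. z ^ m * cnj (z ^ n))"
proof (rule Bochner_Integration.integrable_bound[OF integrable_moment[of "m + n"]])
  have [measurable]: "(\<lambda>z. z ^ m * cnj (z ^ n)) \<in> borel_measurable borel"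
    by (intro borel_measurable_continuous_onI continuous_intros)
  show "(\<lambda>z. z ^ m * cnj (z ^ n)) \<in> borel_measurable M" by measurable
qed (auto simp: norm_mult norm_power power_add)

lemma integrable_poly_product:
  assumes "finite A" "finite B"
  shows "integrable M (\<lambda>z. (\<Sum>m\<in>A. a m * z ^ m) * cnj (\<Sum>n\<in>B. b n * z ^ n))"
proof -
  have "integrable M (\<lambda>z. \<Sum>m\<in>A. \<Sum>n\<in>B. (a m * cnj (b n)) * (z ^ m * cnj (z ^ n)))"
    by (intro Bochner_Integration.integrable_sum integrable_mult_right integrable_monomials)
  then show ?thesis
    by (simp add: sum_product mult_ac)
qed

lemma integrable_poly_square:
  assumes "finite A"
  shows "integrable M (\<lambda>z. (cmod (\<Sum>n\<in>A. a n * z ^ n))\<^sup>2)"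
proof -
  have "integrable M (\<lambda>z. norm ((\<Sum>n\<in>A. a n * z ^ n) * cnj (\<Sum>n\<in>A. a n * z ^ n)))"
    by (intro integrable_norm integrable_poly_product assms)
  then show ?thesis by (simp only: norm_mult complex_mod_cnj power2_eq_square)
qed

lemma polys_orthogonal:
  assumes "finite A" "finite B" "A \<inter> B = {}"
  shows "(LINT z|M. (\<Sum>m\<in>A. a m * z ^ m) * cnj (\<Sum>n\<in>B. b n * z ^ n)) = 0"
proof -
  have "(LINT z|M. (\<Sum>m\<in>A. a m * z ^ m) * cnj (\<Sum>n\<in>B. b n * z ^ n))
      = (LINT z|M. (\<Sum>m\<in>A. \<Sum>n\<in>B. (a m * cnj (b n)) * (z ^ m * cnj (z ^ n))))"
    by (simp add: sum_product mult_ac)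
  also have "\<dots> = (\<Sum>m\<in>A. \<Sum>n\<in>B. (a m * cnj (b n)) * (LINT z|M. z ^ m * cnj (z ^ n)))"
    by (simp add: Bochner_Integration.integral_sum integrable_monomials del: complex_cnj_power)
  also have "\<dots> = 0"
  proof (intro sum.neutral ballI)
    fix m n assume "m \<in> A" "n \<in> B"
    then have "m \<noteq> n" using assms(3) by blast
    from monomials_orthogonal[OF this]
    show "a m * cnj (b n) * (LINT z|M. z ^ m * cnj (z ^ n)) = 0"
      by (simp only: mult_zero_right)
  qed
  finally show ?thesis .
qed

lemma polys_pythagoras:
  assumes "finite A" "finite B" "A \<inter> B = {}"
  shows "(LINT z|M. (cmod (\<Sum>n\<in>A \<union> B. a n * z ^ n))\<^sup>2)
       = (LINT z|M. (cmod (\<Sum>n\<in>A. a n * z ^ n))\<^sup>2) + (LINT z|M. (cmod (\<Sum>n\<in>B. a n * z ^ n))\<^sup>2)"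
proof -
  let ?S = "\<lambda>A z. \<Sum>n\<in>A. a n * z ^ n"
  have cross: "integrable M (\<lambda>z. ?S A z * cnj (?S B z))"
    by (intro integrable_poly_product assms)
  have "(cmod (?S (A \<union> B) z))\<^sup>2 = (cmod (?S A z))\<^sup>2 + (cmod (?S B z))\<^sup>2 + 2 * Re (?S A z * cnj (?S B z))" for z
  proof -
    have "?S (A \<union> B) z = ?S A z + ?S B z"
      by (rule sum.union_disjoint) (use assms in auto)
    moreover have "(cmod (x + y))\<^sup>2 = (cmod x)\<^sup>2 + (cmod y)\<^sup>2 + 2 * Re (x * cnj y)" for x y
      unfolding cmod_power2 by (simp add: power2_eq_square algebra_simps)
    ultimately show ?thesis by presburger
  qed
  then have "(LINT z|M. (cmod (?S (A \<union> B) z))\<^sup>2) = (LINT z|M. (cmod (?S A z))\<^sup>2) + (LINT z|M. (cmod (?S B z))\<^sup>2)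
      + 2 * Re (LINT z|M. ?S A z * cnj (?S B z))"
    using cross assms by (simp add: integrable_poly_square del: cnj_sum complex_cnj_mult complex_cnj_power times_complex.sel)
  then show ?thesis
    by (simp only: polys_orthogonal[OF assms]) simp
qed


lemma borel_measurable_entire:
  assumes "f holomorphic_on UNIV"
  shows "f \<in> borel_measurable M"
proof -
  have "f \<in> borel_measurable borel"
    using assms by (intro borel_measurable_continuous_onI holomorphic_on_imp_continuous_on)
  then show ?thesis by (simp cong: measurable_cong_sets add: sets_eq_borel)
qed

definition disc :: "real \<Rightarrow> complex measure" where
  "disc R = density M (\<lambda>z. ennreal (indicat_real (cball 0 R) z))"

lemma measurable_indicator_cball [measurable]: "indicat_real (cball (0::complex) R) \<in> borel_measurable M"
  by (intro borel_measurable_indicator) (simp add: sets_eq_borel)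

lemma integral_disc:
  fixes h :: "complex \<Rightarrow> real"
  assumes [measurable]: "h \<in> borel_measurable M"
  shows "(LINT z|disc R. h z) = (LINT z|M. indicat_real (cball 0 R) z * h z)"
  unfolding disc_def by (subst integral_density) auto

lemma radial_measure_disc: "radial_measure (disc R)"
proof
  show "sets (disc R) = sets borel" by (simp add: disc_def sets_eq_borel)
  show "distr (disc R) borel ((*) u) = disc R" if u: "cmod u = 1" for u
    unfolding disc_def
  proof (rule distr_density_invariant)
    show "(*) u \<in> M \<rightarrow>\<^sub>M borel" by measurable
    show "(\<lambda>z. ennreal (indicat_real (cball 0 R) z)) \<in> borel_measurable borel"
      by (intro measurable_compose[OF borel_measurable_indicator]) auto
  qed (use u in \<open>auto simp: rotation indicator_def norm_mult\<close>)
  show "integrable (disc R) (\<lambda>z. cmod z ^ n)" for n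
    unfolding disc_def using integrable_moment[of n]
    by (subst integrable_density)
       (auto intro!: Bochner_Integration.integrable_bound[OF integrable_moment[of n]] simp: indicator_def)
qed

lemma AE_disc: "AE z in disc R. cmod z \<le> R"
  unfolding disc_def by (subst AE_density) (auto simp: indicator_def split: if_splits)

lemma integral_disc_tendsto:
  fixes h :: "complex \<Rightarrow> real"
  assumes "integrable M h"
  shows "(\<lambda>k. LINT z|disc (real k). h z) \<longlonglongrightarrow> (LINT z|M. h z)"
proof -
  have [measurable]: "h \<in> borel_measurable M" using assms by auto
  have "(\<lambda>k. LINT z|M. indicat_real (cball 0 (real k)) z * h z) \<longlonglongrightarrow> (LINT z|M. h z)"
  proof (rule integral_dominated_convergence[where w="\<lambda>z. \<bar>h z\<bar>"])
    show "AE z in M. (\<lambda>k. indicat_real (cball 0 (real k)) z * h z) \<longlonglongrightarrow> h z"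
    proof (intro AE_I2 tendsto_eventually)
      fix z :: complex
      obtain k0 where "cmod z \<le> real k0" using real_arch_simple by blast
      then show "\<forall>\<^sub>F k in sequentially. indicat_real (cball 0 (real k)) z * h z = h z"
        by (intro eventually_sequentiallyI[of k0]) (auto simp: indicator_def)
    qed
  qed (use assms in \<open>auto simp: indicator_def\<close>)
  then show ?thesis by (simp add: integral_disc)
qed

lemma integrable_taylor_sum_square: "integrable M (\<lambda>z. (cmod (taylor_sum f N z))\<^sup>2)"
  unfolding taylor_sum_def by (rule integrable_poly_square) simp

lemma taylor_sum_pythagoras:
  assumes "N \<le> K"
  shows "(LINT z|M. (cmod (taylor_sum f K z))\<^sup>2)
       = (LINT z|M. (cmod (taylor_sum f N z))\<^sup>2) + (LINT z|M. (cmod (taylor_sum f K z - taylor_sum f N z))\<^sup>2)"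
proof -
  have un: "{..<K} = {..<N} \<union> {N..<K}" using assms by auto
  have disj: "{..<N} \<inter> {N..<K} = {}" by auto
  have "taylor_sum f K z - taylor_sum f N z = (\<Sum>n\<in>{N..<K}. taylor_coeff f n * z ^ n)" for z
    unfolding taylor_sum_def un by (subst sum.union_disjoint) auto
  then show ?thesis
    using polys_pythagoras[OF _ _ disj, of "taylor_coeff f"]
    unfolding taylor_sum_def un by simp
qed

text \<open>
  On a disc the Taylor polynomials converge pointwise and are uniformly bounded, so dominated
  convergence carries the Pythagorean identity over from polynomials.
\<close>
lemma taylor_pythagoras_bounded:
  assumes f: "f holomorphic_on UNIV" and R: "AE z in M. cmod z \<le> R"
  shows "(\<lambda>N. LINT z|M. (cmod (taylor_sum f N z))\<^sup>2) \<longlonglongrightarrow> (LINT z|M. (cmod (f z))\<^sup>2)" (is ?lim)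
    and "(LINT z|M. (cmod (f z))\<^sup>2)
       = (LINT z|M. (cmod (taylor_sum f N z))\<^sup>2) + (LINT z|M. (cmod (f z - taylor_sum f N z))\<^sup>2)" (is ?eq)
proof -
  obtain B where B: "\<And>N z. cmod z \<le> R \<Longrightarrow> cmod (taylor_sum f N z) \<le> B"
    using taylor_sum_bounded_on_cball[OF f] by metis
  have const: "integrable M (\<lambda>z. c :: real)" for c
    using integrable_mult_right[OF integrable_moment[of 0], of c] by simp
  have [measurable]: "f \<in> borel_measurable M" "taylor_sum f N \<in> borel_measurable M" for N
    by (auto intro!: borel_measurable_entire f holomorphic_intros simp: taylor_sum_def[abs_def])
  show ?lim
  proof (rule integral_dominated_convergence[where w="\<lambda>_. B\<^sup>2"])
    show "AE z in M. (\<lambda>N. (cmod (taylor_sum f N z))\<^sup>2) \<longlonglongrightarrow> (cmod (f z))\<^sup>2"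
      by (intro AE_I2 tendsto_intros taylor_sum_tendsto f)
    show "AE z in M. norm ((cmod (taylor_sum f N z))\<^sup>2) \<le> B\<^sup>2" for N
      using R by eventually_elim (auto intro!: power_mono B)
  qed (use const in auto)
  moreover have "(\<lambda>K. LINT z|M. (cmod (taylor_sum f K z - taylor_sum f N z))\<^sup>2)
      \<longlonglongrightarrow> (LINT z|M. (cmod (f z - taylor_sum f N z))\<^sup>2)"
  proof (rule integral_dominated_convergence[where w="\<lambda>_. (B + B)\<^sup>2"])
    show "AE z in M. (\<lambda>K. (cmod (taylor_sum f K z - taylor_sum f N z))\<^sup>2) \<longlonglongrightarrow> (cmod (f z - taylor_sum f N z))\<^sup>2"
      by (intro AE_I2 tendsto_intros taylor_sum_tendsto f)
    show "AE z in M. norm ((cmod (taylor_sum f K z - taylor_sum f N z))\<^sup>2) \<le> (B + B)\<^sup>2" for K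
      using R
    proof eventually_elim
      case (elim z)
      then have "cmod (taylor_sum f K z - taylor_sum f N z) \<le> B + B"
        using B[of z K] B[of z N] norm_triangle_ineq4[of "taylor_sum f K z" "taylor_sum f N z"] by linarith
      from power_mono[OF this, of 2] show ?case by simp
    qed
  qed (use const in auto)
  ultimately have "(\<lambda>K. (LINT z|M. (cmod (taylor_sum f K z))\<^sup>2) - (LINT z|M. (cmod (taylor_sum f K z - taylor_sum f N z))\<^sup>2))
      \<longlonglongrightarrow> (LINT z|M. (cmod (f z))\<^sup>2) - (LINT z|M. (cmod (f z - taylor_sum f N z))\<^sup>2)"
    by (rule tendsto_diff)
  moreover have "(\<lambda>K. (LINT z|M. (cmod (taylor_sum f K z))\<^sup>2) - (LINT z|M. (cmod (taylor_sum f K z - taylor_sum f N z))\<^sup>2))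
      \<longlonglongrightarrow> (LINT z|M. (cmod (taylor_sum f N z))\<^sup>2)"
  proof (intro tendsto_eventually eventually_sequentiallyI[of N])
    fix K assume "N \<le> K"
    from taylor_sum_pythagoras[OF this, of f]
    show "(LINT z|M. (cmod (taylor_sum f K z))\<^sup>2) - (LINT z|M. (cmod (taylor_sum f K z - taylor_sum f N z))\<^sup>2)
        = (LINT z|M. (cmod (taylor_sum f N z))\<^sup>2)" by simp
  qed
  ultimately show ?eq
    using LIMSEQ_unique by fastforce
qed

lemma integrable_taylor_remainder_square:
  assumes f: "f holomorphic_on UNIV" and int: "integrable M (\<lambda>z. (cmod (f z))\<^sup>2)"
  shows "integrable M (\<lambda>z. (cmod (f z - taylor_sum f N z))\<^sup>2)"
proof (rule Bochner_Integration.integrable_bound)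
  show "integrable M (\<lambda>z. 2 * (cmod (f z))\<^sup>2 + 2 * (cmod (taylor_sum f N z))\<^sup>2)"
    by (intro Bochner_Integration.integrable_add integrable_mult_right int integrable_taylor_sum_square)
  have [measurable]: "f \<in> borel_measurable M" "taylor_sum f N \<in> borel_measurable M"
    by (auto intro!: borel_measurable_entire f holomorphic_intros simp: taylor_sum_def[abs_def])
  show "(\<lambda>z. (cmod (f z - taylor_sum f N z))\<^sup>2) \<in> borel_measurable M" by measurable
  show "AE z in M. norm ((cmod (f z - taylor_sum f N z))\<^sup>2)
      \<le> norm (2 * (cmod (f z))\<^sup>2 + 2 * (cmod (taylor_sum f N z))\<^sup>2)"
  proof (intro AE_I2)
    fix z
    have "(cmod (f z - taylor_sum f N z))\<^sup>2 \<le> (cmod (f z) + cmod (taylor_sum f N z))\<^sup>2"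
      by (intro power_mono norm_triangle_ineq4) simp
    also have "\<dots> \<le> 2 * (cmod (f z))\<^sup>2 + 2 * (cmod (taylor_sum f N z))\<^sup>2"
      using sum_squares_bound[of "cmod (f z)" "cmod (taylor_sum f N z)"]
      by (simp add: power2_sum)
    finally show "norm ((cmod (f z - taylor_sum f N z))\<^sup>2)
      \<le> norm (2 * (cmod (f z))\<^sup>2 + 2 * (cmod (taylor_sum f N z))\<^sup>2)" by simp
  qed
qed

text \<open>
  Nothing bounds the Taylor polynomials uniformly on the whole plane, so a limit of the identities
  between polynomials is not directly justified there. Instead the identity holds on the disc of
  radius \<open>k\<close>, and all three integrals converge as \<open>k\<close> tends to infinity.
\<close>
lemma taylor_pythagoras:
  assumes f: "f holomorphic_on UNIV" and int: "integrable M (\<lambda>z. (cmod (f z))\<^sup>2)"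
  shows "(LINT z|M. (cmod (f z))\<^sup>2)
       = (LINT z|M. (cmod (taylor_sum f N z))\<^sup>2) + (LINT z|M. (cmod (f z - taylor_sum f N z))\<^sup>2)"
proof -
  have "(\<lambda>k. (LINT z|disc (real k). (cmod (taylor_sum f N z))\<^sup>2)
        + (LINT z|disc (real k). (cmod (f z - taylor_sum f N z))\<^sup>2))
      \<longlonglongrightarrow> (LINT z|M. (cmod (taylor_sum f N z))\<^sup>2) + (LINT z|M. (cmod (f z - taylor_sum f N z))\<^sup>2)"
    by (intro tendsto_add integral_disc_tendsto integrable_taylor_sum_square
          integrable_taylor_remainder_square f int)
  moreover have "(LINT z|disc (real k). (cmod (taylor_sum f N z))\<^sup>2)
        + (LINT z|disc (real k). (cmod (f z - taylor_sum f N z))\<^sup>2)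
      = (LINT z|disc (real k). (cmod (f z))\<^sup>2)" for k
    using radial_measure.taylor_pythagoras_bounded(2)[OF radial_measure_disc f AE_disc] by metis
  ultimately show ?thesis
    using LIMSEQ_unique[OF integral_disc_tendsto[OF int]] by simp
qed

text \<open>
  By the Pythagorean identity it suffices that the mass of the Taylor polynomials comes close to
  that of \<open>f\<close>. A large disc carries almost all the mass of \<open>f\<close>; on that disc the masses of the
  Taylor polynomials converge to that of \<open>f\<close>; and their mass on the whole plane is at least as large.
\<close>
lemma taylor_remainder_tendsto_0:
  assumes f: "f holomorphic_on UNIV" and int: "integrable M (\<lambda>z. (cmod (f z))\<^sup>2)"
  shows "(\<lambda>N. LINT z|M. (cmod (f z - taylor_sum f N z))\<^sup>2) \<longlonglongrightarrow> 0"
proof (rule LIMSEQ_I)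
  fix e :: real assume e: "e > 0"
  let ?I = "\<lambda>h. LINT z|M. (cmod (h z))\<^sup>2" and ?D = "\<lambda>k h. LINT z|disc (real k). (cmod (h z))\<^sup>2"
  have "\<forall>\<^sub>F k in sequentially. ?D k f > ?I f - e / 2"
    using order_tendstoD(1)[OF integral_disc_tendsto[OF int], of "?I f - e / 2"] e by simp
  then obtain k where k: "?D k f > ?I f - e / 2"
    by (meson eventually_happens' sequentially_bot)
  have "\<forall>\<^sub>F N in sequentially. ?D k (taylor_sum f N) > ?D k f - e / 2"
    using order_tendstoD(1)[OF radial_measure.taylor_pythagoras_bounded(1)[OF radial_measure_disc f AE_disc, of "real k"],
        of "?D k f - e / 2"] e by simp
  then obtain N0 where N0: "\<And>N. N \<ge> N0 \<Longrightarrow> ?D k (taylor_sum f N) > ?D k f - e / 2"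
    by (auto simp: eventually_sequentially)
  have "norm (?I (\<lambda>z. f z - taylor_sum f N z) - 0) < e" if "N \<ge> N0" for N
  proof -
    have [measurable]: "taylor_sum f N \<in> borel_measurable M"
      by (auto intro!: borel_measurable_entire f holomorphic_intros simp: taylor_sum_def[abs_def])
    have "?D k (taylor_sum f N) \<le> ?I (taylor_sum f N)"
      by (subst integral_disc)
         (auto intro!: integral_mono' integrable_taylor_sum_square simp: indicator_def)
    then have "?I (\<lambda>z. f z - taylor_sum f N z) < e"
      using k N0[OF that] taylor_pythagoras[OF f int, of N] by simp
    then show ?thesis by (simp add: integral_nonneg_AE)
  qed
  then show "\<exists>N0. \<forall>N\<ge>N0. norm (?I (\<lambda>z. f z - taylor_sum f N z) - 0) < e" by blast
qed

text \<open>
  The term of degree \<open>m\<close> is the difference of two consecutive Taylor polynomials, hence one of the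
  orthogonal summands that make up \<open>f\<close>.
\<close>
lemma taylor_coeff_bound:
  assumes f: "f holomorphic_on UNIV" and int: "integrable M (\<lambda>z. (cmod (f z))\<^sup>2)"
  shows "(cmod (taylor_coeff f m))\<^sup>2 * (LINT z|M. (cmod (z ^ m))\<^sup>2) \<le> (LINT z|M. (cmod (f z))\<^sup>2)"
proof -
  let ?I = "\<lambda>h. LINT z|M. (cmod (h z))\<^sup>2"
  have "(cmod (taylor_coeff f m))\<^sup>2 * ?I (\<lambda>z. z ^ m)
      = ?I (\<lambda>z. taylor_sum f (Suc m) z - taylor_sum f m z)"
    by (simp add: taylor_sum_def norm_mult power_mult_distrib)
  also have "\<dots> \<le> ?I (taylor_sum f (Suc m))"
    using taylor_sum_pythagoras[of m "Suc m" f] by (simp add: integral_nonneg_AE)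
  also have "\<dots> \<le> ?I f"
    using taylor_pythagoras[OF f int, of "Suc m"] by (simp add: integral_nonneg_AE)
  finally show ?thesis .
qed

end

section \<open>The Gaussian measure on the complex plane\<close>

lemma integrable_gaussian_real:
  fixes b :: real
  assumes "b > 0"
  shows "integrable lborel (\<lambda>x. exp (- b * x\<^sup>2))"
proof -
  \<comment> \<open>The standard deviation for which the normal density has exponent \<open>- b x\<^sup>2\<close>.\<close>
  define \<sigma> where "\<sigma> = 1 / sqrt (2 * b)"
  have \<sigma>: "0 < \<sigma>" "\<sigma>\<^sup>2 = 1 / (2 * b)" using assms by (auto simp: \<sigma>_def power_divide)
  have "integrable lborel (\<lambda>x. sqrt (2 * pi * \<sigma>\<^sup>2) * normal_density 0 \<sigma> x)"
    using \<sigma> by (intro integrable_mult_right integrable_normal_density)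
  then show ?thesis
    using \<sigma> assms by (simp add: normal_density_def mult.commute)
qed

lemma integrable_gaussian_complex:
  fixes b :: real
  assumes "b > 0"
  shows "integrable lborel (\<lambda>z::complex. exp (- b * (cmod z)\<^sup>2))"
proof (rule integrableI_bounded)
  have fin: "(\<integral>\<^sup>+x. ennreal (exp (- b * x\<^sup>2)) \<partial>lborel) < \<infinity>"
    using integrable_gaussian_real[OF assms] by (simp add: nn_integral_eq_integral)
  have "(\<integral>\<^sup>+z. ennreal (norm (exp (- b * (cmod z)\<^sup>2))) \<partial>lborel)
      = (\<integral>\<^sup>+z. (\<Prod>i\<in>Basis. ennreal (exp (- b * ((z::complex) \<bullet> i)\<^sup>2))) \<partial>lborel)"
    by (intro nn_integral_cong)
       (simp add: Basis_complex_def cmod_power2 ring_distribs mult_exp_exp inner_complex_def flip: ennreal_mult)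
  also have "\<dots> = (\<Prod>i\<in>(Basis :: complex set). \<integral>\<^sup>+x. ennreal (exp (- b * x\<^sup>2)) \<partial>lborel)"
    by (rule nn_integral_lborel_prod) auto
  also have "\<dots> < \<infinity>"
    using fin by (simp add: ennreal_mult_less_top power_less_top_ennreal)
  finally show "(\<integral>\<^sup>+z. ennreal (norm (exp (- b * (cmod (z::complex))\<^sup>2))) \<partial>lborel) < \<infinity>" .
qed measurable

lemma power_le_fact_times_exp:
  fixes y :: real
  assumes "y \<ge> 0"
  shows "y ^ n \<le> fact n * exp y"
proof -
  have "(\<Sum>k\<in>{n}. y ^ k /\<^sub>R fact k) \<le> (\<Sum>k. y ^ k /\<^sub>R fact k)"
    using assms by (intro sum_le_suminf summable_exp_generic) auto
  then show ?thesis by (simp add: exp_def field_simps)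
qed

text \<open>
  Half of the exponent is spent on absorbing the power: with \<open>y = a t\<^sup>2 / 2\<close>, the factor \<open>t\<^sup>n\<close> is at
  most a constant times \<open>exp y\<close>, and a Gaussian with the other half of the exponent remains.
\<close>
lemma integrable_gaussian_moment:
  fixes a :: real
  assumes "a > 0"
  shows "integrable lborel (\<lambda>z::complex. cmod z ^ n * exp (- a * (cmod z)\<^sup>2))"
proof (rule Bochner_Integration.integrable_bound)
  let ?C = "1 + (2 / a) ^ n * fact n"
  show "integrable lborel (\<lambda>z::complex. ?C * exp (- (a / 2) * (cmod z)\<^sup>2))"
    using assms by (intro integrable_mult_right integrable_gaussian_complex) simp
  show "AE z in lborel. norm (cmod z ^ n * exp (- a * (cmod (z::complex))\<^sup>2))
      \<le> norm (?C * exp (- (a / 2) * (cmod z)\<^sup>2))"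
  proof (intro AE_I2)
    fix z :: complex
    define t where "t = cmod z"
    define y where "y = a / 2 * t\<^sup>2"
    have y: "y \<ge> 0" "t \<ge> 0" using assms by (auto simp: y_def t_def)
    have "(t ^ n)\<^sup>2 = (2 / a) ^ n * y ^ n"
      using assms by (simp add: y_def power_mult_distrib[symmetric] power_mult[symmetric] mult.commute)
    also have "\<dots> \<le> (2 / a) ^ n * (fact n * exp y)"
      using assms y by (intro mult_left_mono power_le_fact_times_exp) auto
    finally have "(t ^ n)\<^sup>2 \<le> (2 / a) ^ n * fact n * exp y"
      by (simp add: mult.assoc)
    moreover have "t ^ n \<le> 1 + (t ^ n)\<^sup>2"
      \<comment> \<open>From \<open>0 \<le> (s - 1)\<^sup>2\<close> and \<open>s \<ge> 0\<close> with \<open>s = t\<^sup>n\<close>.\<close>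
      using zero_le_power2[of "t ^ n - 1"] zero_le_power[OF y(2), of n]
      unfolding power2_diff by simp
    moreover have "1 \<le> exp y" using y by simp
    ultimately have "t ^ n \<le> ?C * exp y"
      unfolding distrib_right by linarith
    then have "t ^ n * exp (- 2 * y) \<le> ?C * exp y * exp (- 2 * y)"
      by (intro mult_right_mono exp_ge_zero)
    also have "\<dots> = ?C * exp (- y)"
      by (simp add: mult.assoc flip: exp_add)
    finally show "norm (cmod z ^ n * exp (- a * (cmod z)\<^sup>2)) \<le> norm (?C * exp (- (a / 2) * (cmod z)\<^sup>2))"
      using assms by (simp add: y_def t_def)
  qed
qed measurable

definition gauss_measure :: "real \<Rightarrow> complex measure" where
  "gauss_measure \<alpha> = density lborel (\<lambda>z. ennreal (exp (- \<alpha> * (cmod z)\<^sup>2)))"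

lemma radial_measure_gauss:
  assumes "\<alpha> > 0"
  shows "radial_measure (gauss_measure \<alpha>)"
proof
  show "sets (gauss_measure \<alpha>) = sets borel" by (simp add: gauss_measure_def)
  show "distr (gauss_measure \<alpha>) borel ((*) u) = gauss_measure \<alpha>" if u: "cmod u = 1" for u
    unfolding gauss_measure_def
  proof (rule distr_density_invariant)
    show "distr lborel borel ((*) u) = lborel"
      by (rule lborel_distr_orthogonal) (simp add: orthogonal_transformation norm_mult u)
  qed (auto simp: norm_mult u)
  show "integrable (gauss_measure \<alpha>) (\<lambda>z. cmod z ^ n)" for n
    unfolding gauss_measure_def using integrable_gaussian_moment[OF assms, of n]
    by (subst integrable_density) (auto simp: mult.commute)
qed

section \<open>Taylor expansion in the Fock space\<close>

lemma fock_space_iff: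
  "f \<in> fock_space \<alpha> \<longleftrightarrow> f holomorphic_on UNIV \<and> integrable (gauss_measure \<alpha>) (\<lambda>z. (cmod (f z))\<^sup>2)"
proof (cases "f holomorphic_on UNIV")
  case True
  then have [measurable]: "f \<in> borel_measurable borel"
    by (intro borel_measurable_continuous_onI holomorphic_on_imp_continuous_on)
  show ?thesis
    unfolding gauss_measure_def fock_space_def
    by (subst integrable_density) (auto simp: mult.commute)
qed (simp add: fock_space_def)

lemma fock_norm_eq:
  assumes "f holomorphic_on UNIV"
  shows "fock_norm \<alpha> f = sqrt (\<alpha> / pi * (LINT z|gauss_measure \<alpha>. (cmod (f z))\<^sup>2))"
proof -
  have [measurable]: "f \<in> borel_measurable borel"
    using assms by (intro borel_measurable_continuous_onI holomorphic_on_imp_continuous_on)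
  show ?thesis
    unfolding gauss_measure_def fock_norm_def
    by (subst integral_density) (auto simp: mult.commute)
qed

lemma monomial_in_fock_space:
  assumes "\<alpha> > 0"
  shows "(\<lambda>z. z ^ n) \<in> fock_space \<alpha>"
  using radial_measure.integrable_moment[OF radial_measure_gauss[OF assms], of "2 * n"]
  by (auto simp: fock_space_iff norm_power power_mult[symmetric] mult.commute intro!: holomorphic_intros)

lemma fock_space_cmult:
  assumes "f \<in> fock_space \<alpha>"
  shows "(\<lambda>z. c * f z) \<in> fock_space \<alpha>"
  using assms by (auto simp: fock_space_iff norm_mult power_mult_distrib intro!: holomorphic_intros)

lemma fock_norm_cmult: "fock_norm \<alpha> (\<lambda>z. c * f z) = cmod c * fock_norm \<alpha> f"
proof -
  have "\<alpha> / pi * (LINT z|lborel. (cmod (c * f z))\<^sup>2 * exp (- \<alpha> * (cmod z)\<^sup>2))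
     = (cmod c)\<^sup>2 * (\<alpha> / pi * (LINT z|lborel. (cmod (f z))\<^sup>2 * exp (- \<alpha> * (cmod z)\<^sup>2)))"
    by (simp add: norm_mult power_mult_distrib mult.assoc)
  then show ?thesis unfolding fock_norm_def by (simp only: real_sqrt_mult real_sqrt_abs abs_norm_cancel)
qed

lemma fock_norm_monomial_pos:
  assumes "\<alpha> > 0"
  shows "fock_norm \<alpha> (\<lambda>z. z ^ n) > 0"
proof -
  let ?g = "\<lambda>z::complex. (cmod (z ^ n))\<^sup>2 * exp (- \<alpha> * (cmod z)\<^sup>2)"
  have int: "integrable lborel ?g"
    using monomial_in_fock_space[OF assms, of n] by (simp add: fock_space_def)
  have "(LINT z|lborel. ?g z) \<noteq> 0"
  proof
    assume "(LINT z|lborel. ?g z) = 0"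
    then have "AE z in lborel. ?g z = 0"
      using integral_nonneg_eq_0_iff_AE[OF int] by simp
    moreover have "AE z in lborel. z \<noteq> (0::complex)" by (rule AE_lborel_singleton)
    ultimately have "AE z in (lborel :: complex measure). False"
      by eventually_elim simp
    then show False by (simp add: AE_iff_null null_sets_def)
  qed
  moreover have "(LINT z|lborel. ?g z) \<ge> 0" by (intro integral_nonneg_AE) auto
  ultimately have "(LINT z|lborel. ?g z) > 0" by linarith
  then show ?thesis using assms by (simp add: fock_norm_def)
qed

lemma fock_coeff_bound:
  assumes "\<alpha> > 0" "f \<in> fock_space \<alpha>"
  shows "cmod (taylor_coeff f n) * fock_norm \<alpha> (\<lambda>z. z ^ n) \<le> fock_norm \<alpha> f"
proof -
  have f: "f holomorphic_on UNIV" "integrable (gauss_measure \<alpha>) (\<lambda>z. (cmod (f z))\<^sup>2)"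
    using assms(2) by (auto simp: fock_space_iff)
  let ?I = "\<lambda>h. LINT z|gauss_measure \<alpha>. (cmod (h z))\<^sup>2"
  have "cmod (taylor_coeff f n) * fock_norm \<alpha> (\<lambda>z. z ^ n)
      = sqrt (\<alpha> / pi * ((cmod (taylor_coeff f n))\<^sup>2 * ?I (\<lambda>z. z ^ n)))"
    by (subst fock_norm_eq) (auto simp: real_sqrt_mult real_sqrt_divide intro!: holomorphic_intros)
  also have "\<dots> \<le> sqrt (\<alpha> / pi * ?I f)"
    using radial_measure.taylor_coeff_bound[OF radial_measure_gauss[OF assms(1)] f, of n] assms(1)
    by (intro real_sqrt_le_mono mult_left_mono) auto
  finally show ?thesis by (simp add: fock_norm_eq[OF f(1)])
qed

lemma fock_taylor_remainder:
  assumes "\<alpha> > 0" "f \<in> fock_space \<alpha>"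
  shows "(\<lambda>z. f z - taylor_sum f N z) \<in> fock_space \<alpha>"
    and "(\<lambda>N. fock_norm \<alpha> (\<lambda>z. f z - taylor_sum f N z)) \<longlonglongrightarrow> 0"
proof -
  have f: "f holomorphic_on UNIV" "integrable (gauss_measure \<alpha>) (\<lambda>z. (cmod (f z))\<^sup>2)"
    using assms(2) by (auto simp: fock_space_iff)
  have hol: "(\<lambda>z. f z - taylor_sum f N z) holomorphic_on UNIV" for N
    using f by (auto simp: taylor_sum_def intro!: holomorphic_intros)
  note M = radial_measure_gauss[OF assms(1)]
  show "(\<lambda>z. f z - taylor_sum f N z) \<in> fock_space \<alpha>"
    using hol radial_measure.integrable_taylor_remainder_square[OF M f] by (simp add: fock_space_iff)
  have "(\<lambda>N. sqrt (\<alpha> / pi * (LINT z|gauss_measure \<alpha>. (cmod (f z - taylor_sum f N z))\<^sup>2)))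
      \<longlonglongrightarrow> sqrt (\<alpha> / pi * 0)"
    by (intro tendsto_intros radial_measure.taylor_remainder_tendsto_0[OF M f])
  then show "(\<lambda>N. fock_norm \<alpha> (\<lambda>z. f z - taylor_sum f N z)) \<longlonglongrightarrow> 0"
    by (simp add: fock_norm_eq[OF hol])
qed

lemma fock_space_taylor_sum:
  assumes "\<alpha> > 0"
  shows "taylor_sum f N \<in> fock_space \<alpha>"
  using radial_measure.integrable_taylor_sum_square[OF radial_measure_gauss[OF assms], of f N]
  by (auto simp: fock_space_iff taylor_sum_def[abs_def] intro!: holomorphic_intros)

lemma fock_norm_eq_0D:
  assumes "\<alpha> > 0" "f \<in> fock_space \<alpha>" "fock_norm \<alpha> f \<le> 0"
  shows "f = (\<lambda>z. 0)"
proof (rule ext, rule entire_eq_0_if_taylor_coeff_eq_0[of f])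
  show "f holomorphic_on UNIV" using assms(2) by (simp add: fock_space_iff)
  show "taylor_coeff f n = 0" for n
    using fock_coeff_bound[OF assms(1,2), of n] fock_norm_monomial_pos[OF assms(1), of n] assms(3)
    by (smt (verit) mult_pos_pos zero_less_norm_iff)
qed

section \<open>Bounded operators and extended eigenvalues\<close>

text \<open>
  This is density of the polynomials: \<open>X\<close> does not see the Taylor polynomials of \<open>f\<close>, so the norm of
  \<open>X f\<close> is bounded by a multiple of the norm of a remainder, which can be made arbitrarily small.
\<close>
lemma bounded_operator_eq_0_if_monomials:
  assumes \<alpha>: "\<alpha> > 0" and X: "bounded_operator (fock_space \<alpha>) (fock_norm \<alpha>) X"
    and 0: "\<And>n. X (\<lambda>z. z ^ n) = (\<lambda>z. 0)" and f: "f \<in> fock_space \<alpha>"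
  shows "X f = (\<lambda>z. 0)"
proof -
  let ?H = "fock_space \<alpha>"
  have add: "\<And>f g. f \<in> ?H \<Longrightarrow> g \<in> ?H \<Longrightarrow> X (\<lambda>z. f z + g z) = (\<lambda>z. X f z + X g z)"
    and scale: "\<And>c f. f \<in> ?H \<Longrightarrow> X (\<lambda>z. c * f z) = (\<lambda>z. c * X f z)"
    and XH: "X f \<in> ?H"
    using X f by (auto simp: bounded_operator_def)
  have "\<exists>B. \<forall>f\<in>?H. fock_norm \<alpha> (X f) \<le> B * fock_norm \<alpha> f"
    using X by (simp add: bounded_operator_def)
  then obtain B where B: "\<And>f. f \<in> ?H \<Longrightarrow> fock_norm \<alpha> (X f) \<le> B * fock_norm \<alpha> f"
    by blast
  have mono: "(\<lambda>z. c * z ^ n) \<in> ?H" "X (\<lambda>z. c * z ^ n) = (\<lambda>z. 0)" for c n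
    using fock_space_cmult[OF monomial_in_fock_space[OF \<alpha>, of n]]
      scale[OF monomial_in_fock_space[OF \<alpha>, of n], of c] by (simp_all add: 0)
  have poly0: "X (taylor_sum f N) = (\<lambda>z. 0)" for N
  proof (induction N)
    case 0
    show ?case using mono(2)[of 0 0] by (simp add: taylor_sum_def[abs_def])
  next
    case (Suc N)
    have "X (taylor_sum f (Suc N)) = X (\<lambda>z. taylor_sum f N z + taylor_coeff f N * z ^ N)"
      by (simp add: taylor_sum_def[abs_def])
    also have "\<dots> = (\<lambda>z. X (taylor_sum f N) z + X (\<lambda>z. taylor_coeff f N * z ^ N) z)"
      by (rule add[OF fock_space_taylor_sum[OF \<alpha>] mono(1)])
    also have "\<dots> = (\<lambda>z. 0)"
      by (simp only: Suc mono(2)) simp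
    finally show ?case .
  qed
  have "fock_norm \<alpha> (X f) \<le> B * fock_norm \<alpha> (\<lambda>z. f z - taylor_sum f N z)" for N
  proof -
    have r: "(\<lambda>z. f z - taylor_sum f N z) \<in> ?H" by (rule fock_taylor_remainder[OF \<alpha> f])
    have "X f = X (\<lambda>z. taylor_sum f N z + (f z - taylor_sum f N z))" by simp
    also have "\<dots> = (\<lambda>z. X (taylor_sum f N) z + X (\<lambda>z. f z - taylor_sum f N z) z)"
      by (rule add[OF fock_space_taylor_sum[OF \<alpha>] r])
    also have "\<dots> = X (\<lambda>z. f z - taylor_sum f N z)"
      by (simp only: poly0) simp
    finally show ?thesis using B[OF r] by simp
  qed
  moreover have "(\<lambda>N. B * fock_norm \<alpha> (\<lambda>z. f z - taylor_sum f N z)) \<longlonglongrightarrow> B * 0"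
    by (intro tendsto_intros fock_taylor_remainder[OF \<alpha> f])
  ultimately have "fock_norm \<alpha> (X f) \<le> 0"
    by (intro LIMSEQ_le_const[where a="fock_norm \<alpha> (X f)" and x=0]) auto
  then show ?thesis by (rule fock_norm_eq_0D[OF \<alpha> XH])
qed

text \<open>
  These rank-one operators, sending \<open>z\<^sup>m\<close> to \<open>z\<^sup>k\<close> and all other monomials to \<open>0\<close>, are the
  intertwiners that realise the extended eigenvalues \<open>w\<^bsup>k - m\<^esup>\<close>.
\<close>
lemma bounded_operator_coeff_monomial:
  assumes \<alpha>: "\<alpha> > 0"
  shows "bounded_operator (fock_space \<alpha>) (fock_norm \<alpha>) (\<lambda>f z. taylor_coeff f m * z ^ k)"
  unfolding bounded_operator_def
proof (intro conjI ballI allI exI)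
  let ?H = "fock_space \<alpha>"
  show "(\<lambda>z. taylor_coeff f m * z ^ k) \<in> ?H" for f
    by (intro fock_space_cmult monomial_in_fock_space \<alpha>)
  show "(\<lambda>z. taylor_coeff (\<lambda>z. f z + g z) m * z ^ k) = (\<lambda>z. taylor_coeff f m * z ^ k + taylor_coeff g m * z ^ k)"
    if "f \<in> ?H" "g \<in> ?H" for f g
    using that by (simp add: fock_space_iff taylor_coeff_add ring_distribs)
  show "(\<lambda>z. taylor_coeff (\<lambda>z. c * f z) m * z ^ k) = (\<lambda>z. c * (taylor_coeff f m * z ^ k))"
    if "f \<in> ?H" for c f
    using that by (simp add: fock_space_iff taylor_coeff_cmult mult.assoc)
  let ?B = "fock_norm \<alpha> (\<lambda>z. z ^ k) / fock_norm \<alpha> (\<lambda>z. z ^ m)"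
  show "fock_norm \<alpha> (\<lambda>z. taylor_coeff f m * z ^ k) \<le> ?B * fock_norm \<alpha> f"
    if "f \<in> ?H" for f
  proof -
    have "cmod (taylor_coeff f m) \<le> fock_norm \<alpha> f / fock_norm \<alpha> (\<lambda>z. z ^ m)"
      using fock_coeff_bound[OF \<alpha> that, of m] fock_norm_monomial_pos[OF \<alpha>, of m]
      by (simp only: pos_le_divide_eq)
    from mult_right_mono[OF this less_imp_le[OF fock_norm_monomial_pos[OF \<alpha>, of k]]]
    show ?thesis
      unfolding fock_norm_cmult times_divide_eq_left by (simp only: mult.commute)
  qed
qed

theorem theorem3p1:
  fixes \<alpha> :: real and w :: complex and \<phi> :: "complex \<Rightarrow> complex"
  assumes "\<alpha> > 0"
    and "cmod w = 1"
    and "\<And>z. \<phi> z = w * z"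
  shows "Ext (fock_space \<alpha>) (fock_norm \<alpha>) (composition_operator \<phi>) = {w powi n | n :: int. True}"
proof (intro equalityI subsetI)
  let ?H = "fock_space \<alpha>"
  note \<alpha> = assms(1)
  have w: "w \<noteq> 0" using assms(2) by auto
  have C: "composition_operator \<phi> f = (\<lambda>z. f (w * z))" for f :: "complex \<Rightarrow> complex"
    by (auto simp: composition_operator_def assms(3))
  show "\<mu> \<in> {w powi n | n :: int. True}" if "\<mu> \<in> Ext ?H (fock_norm \<alpha>) (composition_operator \<phi>)" for \<mu>
  proof -
    from that obtain X f where X: "bounded_operator ?H (fock_norm \<alpha>) X"
      and f: "f \<in> ?H" "X f \<noteq> (\<lambda>z. 0)"
      and comm: "\<And>f. f \<in> ?H \<Longrightarrow> (\<lambda>z. X f (w * z)) = (\<lambda>z. \<mu> * X (\<lambda>z. f (w * z)) z)"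
      by (auto simp: Ext_def C)
    \<comment> \<open>Both sides of the intertwining relation are explicit on a monomial that \<open>X\<close> does not annihilate.\<close>
    obtain m where m: "X (\<lambda>z. z ^ m) \<noteq> (\<lambda>z. 0)"
      using bounded_operator_eq_0_if_monomials[OF \<alpha> X _ f(1)] f(2) by blast
    have mH: "(\<lambda>z. z ^ m) \<in> ?H" by (rule monomial_in_fock_space[OF \<alpha>])
    define g where "g = X (\<lambda>z. z ^ m)"
    have "g \<in> ?H" using X mH by (auto simp: bounded_operator_def g_def)
    then have g: "g holomorphic_on UNIV" by (simp add: fock_space_iff)
    then obtain k where k: "taylor_coeff g k \<noteq> 0"
      using entire_eq_0_if_taylor_coeff_eq_0[OF g] m unfolding g_def by blast
    have "X (\<lambda>z. (w * z) ^ m) = (\<lambda>z. w ^ m * g z)"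
      using X mH by (simp add: bounded_operator_def g_def power_mult_distrib)
    then have "(\<lambda>z. g (w * z)) = (\<lambda>z. (\<mu> * w ^ m) * g z)"
      using comm[OF mH] by (simp add: g_def mult.assoc)
    then have "w ^ k * taylor_coeff g k = (\<mu> * w ^ m) * taylor_coeff g k"
      by (metis taylor_coeff_rotate[OF g] taylor_coeff_cmult[OF g])
    then have "\<mu> = w powi (int k - int m)"
      using k w by (simp add: power_int_diff field_simps)
    then show ?thesis by blast
  qed
  show "\<mu> \<in> Ext ?H (fock_norm \<alpha>) (composition_operator \<phi>)" if "\<mu> \<in> {w powi n | n :: int. True}" for \<mu>
  proof -
    from that obtain n :: int where n: "\<mu> = w powi n" by auto
    \<comment> \<open>Splitting \<open>n\<close> into positive and negative part makes both exponents natural.\<close>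
    define k m where "k = nat n" and "m = nat (- n)"
    have "n = int k - int m" by (simp add: k_def m_def)
    then have \<mu>: "w ^ k = \<mu> * w ^ m" using w by (simp add: n power_int_diff)
    define X where "X = (\<lambda>f z. taylor_coeff f m * z ^ k :: complex)"
    have "X (\<lambda>z. z ^ m) 1 \<noteq> 0" by (simp add: X_def taylor_coeff_monomial)
    then have "X (\<lambda>z. z ^ m) \<noteq> (\<lambda>z. 0)" by metis
    moreover have "composition_operator \<phi> (X f) = (\<lambda>z. \<mu> * X (composition_operator \<phi> f) z)"
      if "f \<in> ?H" for f
    proof
      fix z
      have "taylor_coeff (\<lambda>z. f (w * z)) m = w ^ m * taylor_coeff f m"
        using that by (intro taylor_coeff_rotate) (simp add: fock_space_iff)
      then show "composition_operator \<phi> (X f) z = \<mu> * X (composition_operator \<phi> f) z"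
        by (simp add: C X_def power_mult_distrib \<mu>)
    qed
    ultimately show ?thesis
      using bounded_operator_coeff_monomial[OF \<alpha>, of m k] monomial_in_fock_space[OF \<alpha>, of m]
      unfolding Ext_def X_def by blast
  qed
qed

end
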